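(* Let $c\in\mathbb{Z}$. If $\operatorname{Z}(H) \le \alpha(H) + c$ for all connected cubic graphs $H$, then $\operatorname{Z}(G) \le \alpha(G) + c$ for all connected subcubic graphs $G$.
   Context: All graphs are simple, finite and undirected. A graph is cubic if it is $3$-regular and subcubic if it has maximum degree at most $3$. $\alpha(G)$ is the independence number of $G$. Zero forcing: given a set $B\subseteq V(G)$ of initially blue vertices (the rest white), if a blue vertex has exactly one white neighbor $w$, it can force $w$ to become blue; this rule is applied repeatedly. $B$ is a zero forcing set if all vertices can eventually become blue. $\operatorname{Z}(G)$ is the minimum cardinality of a zero forcing set of $G$. *)

theory Defs
  imports "Graph_Theory.Digraph_Component"
begin

text \<open>
  A simple, finite, undirected graph is a \<^locale>\<open>pair_graph\<close>: a finite, loop-free, symmetric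
  digraph whose arcs are ordered pairs of vertices. An undirected edge is a pair of opposite
  arcs, so the degree of a vertex is its out-degree. The library's notion of a connected
  graph includes having at least one vertex.
\<close>

definition cubic :: "'a pair_pre_digraph \<Rightarrow> bool" where
  "cubic G \<longleftrightarrow> (\<forall>v \<in> pverts G. out_degree (with_proj G) v = 3)"

definition subcubic :: "'a pair_pre_digraph \<Rightarrow> bool" where
  "subcubic G \<longleftrightarrow> (\<forall>v \<in> pverts G. out_degree (with_proj G) v \<le> 3)"

definition independent_set :: "'a pair_pre_digraph \<Rightarrow> 'a set \<Rightarrow> bool" where
  "independent_set G S \<longleftrightarrow> S \<subseteq> pverts G \<and> (\<forall>u \<in> S. \<forall>v \<in> S. (u, v) \<notin> parcs G)"

definition independence_number :: "'a pair_pre_digraph \<Rightarrow> nat" where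
  "independence_number G = Max (card ` {S. independent_set G S})"

definition white_neighbors :: "'a pair_pre_digraph \<Rightarrow> 'a set \<Rightarrow> 'a \<Rightarrow> 'a set" where
  "white_neighbors G B u = {w \<in> pverts G - B. (u, w) \<in> parcs G}"

text \<open>One application of the forcing rule, as a relation between successive sets of blue vertices.\<close>

definition force_step :: "'a pair_pre_digraph \<Rightarrow> 'a set \<Rightarrow> 'a set \<Rightarrow> bool" where
  "force_step G B B' \<longleftrightarrow> (\<exists>u \<in> B. \<exists>w. white_neighbors G B u = {w} \<and> B' = insert w B)"

definition zero_forcing_set :: "'a pair_pre_digraph \<Rightarrow> 'a set \<Rightarrow> bool" where
  "zero_forcing_set G B \<longleftrightarrow> B \<subseteq> pverts G \<and> (force_step G)\<^sup>*\<^sup>* B (pverts G)"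

definition zero_forcing_number :: "'a pair_pre_digraph \<Rightarrow> nat" where
  "zero_forcing_number G = Min (card ` {B. zero_forcing_set G B})"

text \<open>The maximum and the minimum above range over finite nonempty sets.\<close>

lemma (in pair_graph) independence_number_attained:
  "\<exists>S. independent_set G S \<and> card S = independence_number G"
proof -
  have "{S. independent_set G S} \<subseteq> Pow (pverts G)"
    by (auto simp: independent_set_def)
  then have "finite (card ` {S. independent_set G S})"
    by (meson finite_Pow_iff finite_imageI finite_subset pair_finite_verts)
  moreover have "independent_set G {}"
    by (simp add: independent_set_def)
  ultimately have "independence_number G \<in> card ` {S. independent_set G S}"
    unfolding independence_number_def by (intro Max_in) auto
  then show ?thesis by force
qed

lemma (in pair_graph) zero_forcing_number_attained:
  "\<exists>B. zero_forcing_set G B \<and> card B = zero_forcing_number G"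
proof -
  have "{B. zero_forcing_set G B} \<subseteq> Pow (pverts G)"
    by (auto simp: zero_forcing_set_def)
  then have "finite (card ` {B. zero_forcing_set G B})"
    by (meson finite_Pow_iff finite_imageI finite_subset pair_finite_verts)
  moreover have "zero_forcing_set G (pverts G)"
    by (simp add: zero_forcing_set_def)
  ultimately have "zero_forcing_number G \<in> card ` {B. zero_forcing_set G B}"
    unfolding zero_forcing_number_def by (intro Min_in) auto
  then show ?thesis by force
qed

end

theory Submission
  imports Defs
begin

text \<open>
  A subcubic graph is made cubic by hanging small gadgets on its deficient vertices. The gadget has
  five vertices \<open>a, b, c, d, e\<close>: the vertices \<open>b, c, d, e\<close> form a complete graph \<open>K\<^sub>4\<close> without the
  edge \<open>bc\<close>, and \<open>a\<close> is joined to \<open>b\<close> and \<open>c\<close>. Every gadget vertex except \<open>a\<close> has degree three, and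
  joining \<open>a\<close> to a vertex \<open>v\<close> of degree less than three completes \<open>a\<close> as well, while the degree of
  \<open>v\<close> grows by one. The point is that one gadget adds at most two to the independence number
  and at least two to the zero forcing number, so that an upper bound on the difference
  \<open>Z - \<alpha>\<close> for the enlarged graph \<open>H\<close> is inherited by the original graph \<open>G\<close>.

  The bound on the independence number (\<open>independence_number_H\<close>) is immediate. For the zero forcing
  number (\<open>zero_forcing_number_H\<close>), observe that \<open>b, c\<close> are twins and \<open>d, e\<close> are twins. Two white
  twins block every force into them, so a zero forcing set \<open>B\<close> of \<open>H\<close> contains one vertex of each
  pair, hence at least two gadget vertices. If there are exactly two, then no force happens
  inside the gadget before \<open>a\<close> is blue; so \<open>v\<close> becomes blue without help from the gadget and
  \<open>B\<close> restricted to \<open>G\<close> is a zero forcing set of \<open>G\<close>. If there are more than two, then \<open>G\<close> is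
  forced by its share of \<open>B\<close> together with \<open>v\<close>. Either way at least two vertices are saved.

  All arguments about forcing go through the sets at which forcing stops (\<open>stalled\<close>): a set is zero
  forcing if and only if the only stalled set above it is the whole vertex set. It then
  suffices to extend a stalled set of \<open>G\<close> to one of \<open>H\<close>, and no sequence of forces has to be simulated.

  Gadgets are attached until the graph is cubic, by induction on the total missing degree. Each
  step needs new vertices, so \<open>G\<close> is first relabelled by natural numbers.
\<close>

section \<open>Neighbourhoods, degrees and connectedness\<close>

lemma (in pair_wf_digraph) out_degree_eq_card_Image:
  "out_degree (with_proj G) u = card (parcs G `` {u})"
proof -
  have "bij_betw snd (out_arcs (with_proj G) u) (parcs G `` {u})"
    by (auto simp: bij_betw_def inj_on_def out_arcs_def image_iff Bex_def)
  then show ?thesis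
    unfolding out_degree_def by (rule bij_betw_same_card)
qed

lemma (in pair_wf_digraph) white_neighbors_eq_Image:
  "white_neighbors G B u = parcs G `` {u} - B"
  unfolding white_neighbors_def using in_arcsD2 by auto

lemma pair_graphI:
  assumes "pair_wf_digraph G" "finite (pverts G)" "finite (parcs G)" "symmetric (with_proj G)"
    and "\<And>x. x \<in> parcs G \<Longrightarrow> fst x \<noteq> snd x"
  shows "pair_graph G"
  using assms
  by (simp add: pair_graph_def pair_digraph_def pair_pseudo_graph_def pair_sym_digraph_def
      pair_fin_digraph_def pair_fin_digraph_axioms_def pair_sym_digraph_axioms_def
      pair_loopfree_digraph_def pair_loopfree_digraph_axioms_def)

text \<open>
  Connectedness as the absence of a proper nonempty vertex set that no arc leaves. In
  this form it passes to graph extensions and relabellings without handling paths.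
\<close>

lemma (in pair_graph) connected_iff_no_closed_subset:
  "Digraph_Component.connected (with_proj G) \<longleftrightarrow>
    pverts G \<noteq> {} \<and>
    (\<forall>X. X \<subseteq> pverts G \<and> X \<noteq> {} \<and> parcs G `` X \<subseteq> X \<longrightarrow> X = pverts G)"
    (is "?L \<longleftrightarrow> ?V \<and> ?R")
proof -
  have sym: "(parcs G)\<^sup>s = parcs G"
    using arcs_symmetric by (auto simp: symcl_def)
  have conv: "?L \<longleftrightarrow> ?V \<and>
      (\<forall>u\<in>pverts G. \<forall>w\<in>pverts G. (u, w) \<in> rtrancl_on (pverts G) (parcs G))"
    using connected_conv[of "with_proj G"] by (simp add: sym)
  show ?thesis
  proof
    assume L: ?L
    have "X = pverts G" if X: "X \<subseteq> pverts G" "X \<noteq> {}" "parcs G `` X \<subseteq> X" for X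
    proof -
      obtain x where x: "x \<in> X" using X by auto
      have "w \<in> X" if "w \<in> pverts G" for w
      proof -
        have "(x, w) \<in> rtrancl_on (pverts G) (parcs G)"
          using L conv x X that by blast
        then show ?thesis
          by (induction rule: rtrancl_on_induct) (use x X in auto)
      qed
      with X show ?thesis by blast
    qed
    with L conv show "?V \<and> ?R" by blast
  next
    assume R: "?V \<and> ?R"
    have "(u, w) \<in> rtrancl_on (pverts G) (parcs G)"
      if u: "u \<in> pverts G" and w: "w \<in> pverts G" for u w
    proof -
      \<comment> \<open>the vertices reachable from \<open>u\<close> form a closed set\<close>
      let ?X = "{x. (u, x) \<in> rtrancl_on (pverts G) (parcs G)}"
      have "?X \<subseteq> pverts G" by (auto dest: in_rtrancl_on_in_F)
      moreover have "u \<in> ?X" using u by simp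
      moreover have "parcs G `` ?X \<subseteq> ?X"
        using in_arcsD2 by (auto intro: rtrancl_on_into_rtrancl_on)
      ultimately have "?X = pverts G" using R by blast
      with w show ?thesis by blast
    qed
    with R conv show ?L by blast
  qed
qed


section \<open>Extremal characterisations of the two parameters\<close>

lemma (in pair_graph) card_le_independence_number:
  assumes "independent_set G S"
  shows "card S \<le> independence_number G"
proof -
  have "{S. independent_set G S} \<subseteq> Pow (pverts G)"
    by (auto simp: independent_set_def)
  then have "finite {S. independent_set G S}"
    by (meson finite_Pow_iff finite_subset pair_finite_verts)
  with assms show ?thesis
    unfolding independence_number_def by (intro Max_ge) auto
qed

lemma (in pair_graph) zero_forcing_number_le_card:
  assumes "zero_forcing_set G B"
  shows "zero_forcing_number G \<le> card B"
proof -
  have "{B. zero_forcing_set G B} \<subseteq> Pow (pverts G)"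
    by (auto simp: zero_forcing_set_def)
  then have "finite {B. zero_forcing_set G B}"
    by (meson finite_Pow_iff finite_subset pair_finite_verts)
  with assms show ?thesis
    unfolding zero_forcing_number_def by (intro Min_le) auto
qed

definition stalled :: "'a pair_pre_digraph \<Rightarrow> 'a set \<Rightarrow> bool" where
  "stalled G C \<longleftrightarrow> C \<subseteq> pverts G \<and> (\<forall>u\<in>C. \<forall>w. parcs G `` {u} - C \<noteq> {w})"

text \<open>
  Forcing is monotone: a vertex forced by a subset of a stalled set already lies in the stalled set,
  since otherwise it would be the only white neighbour there, too. So the process started
  inside a stalled set never leaves it. Conversely, a maximal set reached from \<open>B\<close> is stalled.
\<close>

lemma (in pair_graph) zero_forcing_set_iff_stalled:
  assumes B: "B \<subseteq> pverts G"
  shows "zero_forcing_set G B \<longleftrightarrow> (\<forall>C. B \<subseteq> C \<and> stalled G C \<longrightarrow> C = pverts G)"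
proof
  assume L: "zero_forcing_set G B"
  have "C = pverts G" if C: "B \<subseteq> C" "stalled G C" for C
  proof -
    have "B' \<subseteq> C" if "(force_step G)\<^sup>*\<^sup>* B B'" for B'
      using that
    proof induction
      case base
      show ?case by fact
    next
      case (step B1 B2)
      then obtain u w where uw: "u \<in> B1" "parcs G `` {u} - B1 = {w}" "B2 = insert w B1"
        unfolding force_step_def white_neighbors_eq_Image by blast
      have "w \<in> C"
      proof (rule ccontr)
        assume "w \<notin> C"
        then have "parcs G `` {u} - C = {w}"
          using uw step.IH by blast
        with C uw step.IH show False unfolding stalled_def by blast
      qed
      with uw step.IH show ?case by blast
    qed
    with L C show ?thesis
      unfolding zero_forcing_set_def stalled_def by blast
  qed
  then show "\<forall>C. B \<subseteq> C \<and> stalled G C \<longrightarrow> C = pverts G" by blast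
next
  assume R: "\<forall>C. B \<subseteq> C \<and> stalled G C \<longrightarrow> C = pverts G"
  let ?F = "{C. (force_step G)\<^sup>*\<^sup>* B C}"
  have sub: "B \<subseteq> C \<and> C \<subseteq> pverts G" if "(force_step G)\<^sup>*\<^sup>* B C" for C
    using that by induction (use B in \<open>auto simp: force_step_def white_neighbors_def\<close>)
  then have "?F \<subseteq> Pow (pverts G)" by blast
  then have "finite ?F"
    by (meson finite_Pow_iff finite_subset pair_finite_verts)
  moreover have "B \<in> ?F" by simp
  ultimately obtain C where C: "C \<in> ?F" and max: "\<And>D. D \<in> ?F \<Longrightarrow> C \<subseteq> D \<Longrightarrow> C = D"
    using finite_has_maximal[of ?F] by blast
  have "stalled G C"
    unfolding stalled_def
  proof (intro conjI ballI allI notI)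
    show "C \<subseteq> pverts G" using sub C by blast
    fix u w
    assume u: "u \<in> C" "parcs G `` {u} - C = {w}"
    then have "force_step G C (insert w C)"
      unfolding force_step_def white_neighbors_eq_Image by blast
    then have "insert w C \<in> ?F"
      using C by (auto intro: rtranclp.rtrancl_into_rtrancl)
    with max have "C = insert w C" by blast
    with u show False by blast
  qed
  with R C sub have "C = pverts G" by blast
  with C B show "zero_forcing_set G B"
    unfolding zero_forcing_set_def by simp
qed

text \<open>
  A vertex outside a pair of twins sees both of them or neither. If both twins are white, it
  cannot force either, so the complement of the pair is stalled. This covers adjacent twins,
  such as \<open>d, e\<close> in the gadget below, as well as nonadjacent ones, such as \<open>b, c\<close>.
\<close>

lemma (in pair_graph) zero_forcing_set_meets_twins:
  assumes B: "zero_forcing_set G B"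
    and p: "p \<in> pverts G" and neq: "p \<noteq> q"
    and twins: "\<And>u. u \<in> pverts G \<Longrightarrow> u \<notin> {p, q} \<Longrightarrow> (u, p) \<in> parcs G \<longleftrightarrow> (u, q) \<in> parcs G"
  shows "B \<inter> {p, q} \<noteq> {}"
proof
  assume disj: "B \<inter> {p, q} = {}"
  have B_sub: "B \<subseteq> pverts G" using B by (simp add: zero_forcing_set_def)
  have "stalled G (pverts G - {p, q})"
    unfolding stalled_def
  proof (intro conjI ballI allI)
    fix u w
    assume u: "u \<in> pverts G - {p, q}"
    have white: "parcs G `` {u} - (pverts G - {p, q}) = parcs G `` {u} \<inter> {p, q}"
      using in_arcsD2 by blast
    have "p \<in> parcs G `` {u} \<longleftrightarrow> q \<in> parcs G `` {u}"
      using u twins by simp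
    then consider "parcs G `` {u} \<inter> {p, q} = {}" | "parcs G `` {u} \<inter> {p, q} = {p, q}"
      by blast
    then show "parcs G `` {u} - (pverts G - {p, q}) \<noteq> {w}"
      unfolding white by cases (use neq in \<open>simp_all only:\<close>, auto)
  qed blast
  moreover have "B \<subseteq> pverts G - {p, q}" using B_sub disj by blast
  ultimately have "pverts G - {p, q} = pverts G"
    using B unfolding zero_forcing_set_iff_stalled[OF B_sub] by blast
  with p show False by blast
qed


section \<open>A pendant gadget\<close>

locale gadget_attachment = pair_graph G for G :: "'a pair_pre_digraph" +
  fixes v a b c d e :: 'a
  assumes v_in: "v \<in> pverts G"
    and fresh: "{a, b, c, d, e} \<inter> pverts G = {}"
    and distinct_gadget: "distinct [a, b, c, d, e]"
begin

text \<open>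
  Each edge is listed in one direction only; the converse relation supplies the opposite arcs.
\<close>

definition gadget_edges :: "'a rel" where
  "gadget_edges = {(v, a), (a, b), (a, c), (b, d), (b, e), (c, d), (c, e), (d, e)}"

definition H :: "'a pair_pre_digraph" where
  "H = \<lparr> pverts = pverts G \<union> {a, b, c, d, e},
         parcs = parcs G \<union> gadget_edges \<union> gadget_edges\<inverse> \<rparr>"

lemma pverts_H: "pverts H = pverts G \<union> {a, b, c, d, e}"
  by (simp add: H_def)

lemma parcs_H: "parcs H = parcs G \<union> gadget_edges \<union> gadget_edges\<inverse>"
  by (simp add: H_def)

lemma fresh_simps [simp]:
  "a \<notin> pverts G" "b \<notin> pverts G" "c \<notin> pverts G" "d \<notin> pverts G" "e \<notin> pverts G"
  "a \<noteq> b" "a \<noteq> c" "a \<noteq> d" "a \<noteq> e" "b \<noteq> c" "b \<noteq> d" "b \<noteq> e" "c \<noteq> d" "c \<noteq> e" "d \<noteq> e"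
  "b \<noteq> a" "c \<noteq> a" "d \<noteq> a" "e \<noteq> a" "c \<noteq> b" "d \<noteq> b" "e \<noteq> b" "d \<noteq> c" "e \<noteq> c" "e \<noteq> d"
  using fresh distinct_gadget by auto

lemma attachment_vertex_neq_gadget [simp]:
  "v \<noteq> a" "v \<noteq> b" "v \<noteq> c" "v \<noteq> d" "v \<noteq> e" "a \<noteq> v" "b \<noteq> v" "c \<noteq> v" "d \<noteq> v" "e \<noteq> v"
  using fresh v_in by blast+

lemma no_arc_at_fresh_vertex:
  assumes "x \<in> {a, b, c, d, e}"
  shows "(x, u) \<notin> parcs G" "(u, x) \<notin> parcs G"
  using assms fresh in_arcsD1 in_arcsD2 by blast+

lemma Image_gadget [simp]:
  "parcs H `` {a} = {v, b, c}" "parcs H `` {b} = {a, d, e}" "parcs H `` {c} = {a, d, e}"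
  "parcs H `` {d} = {b, c, e}" "parcs H `` {e} = {b, c, d}"
  by (auto simp: parcs_H gadget_edges_def no_arc_at_fresh_vertex)

lemma Image_attachment_vertex [simp]: "parcs H `` {v} = insert a (parcs G `` {v})"
  by (auto simp: parcs_H gadget_edges_def)

lemma Image_old:
  assumes "u \<in> pverts G" "u \<noteq> v"
  shows "parcs H `` {u} = parcs G `` {u}"
  using assms by (auto simp: parcs_H gadget_edges_def)

lemma pair_graph_H: "pair_graph H"
proof (rule pair_graphI)
  show "pair_wf_digraph H"
    using wellformed' v_in
    by unfold_locales (auto simp: pverts_H parcs_H gadget_edges_def)
  show "finite (parcs H)"
    using pair_finite_arcs by (simp add: parcs_H gadget_edges_def)
  show "finite (pverts H)"
    using pair_finite_verts by (simp add: pverts_H)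
  show "symmetric (with_proj H)"
    using arcs_symmetric unfolding symmetric_def sym_def with_proj_simps parcs_H by blast
  show "fst x \<noteq> snd x" if "x \<in> parcs H" for x
    using that no_loops' by (auto simp: parcs_H gadget_edges_def)
qed

sublocale H: pair_graph H
  by (rule pair_graph_H)

lemma connected_H:
  assumes conn: "Digraph_Component.connected (with_proj G)"
  shows "Digraph_Component.connected (with_proj H)"
  unfolding H.connected_iff_no_closed_subset
proof (intro conjI allI impI)
  show "pverts H \<noteq> {}" by (auto simp: pverts_H)
  fix X
  assume X: "X \<subseteq> pverts H \<and> X \<noteq> {} \<and> parcs H `` X \<subseteq> X"
  then have closed: "u \<in> X \<Longrightarrow> parcs H `` {u} \<subseteq> X" for u by blast
  \<comment> \<open>every vertex of the gadget leads to \<open>a\<close>, hence to \<open>v\<close>, and \<open>v\<close> leads to all of them\<close>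
  have spread: "v \<in> X \<Longrightarrow> a \<in> X" "a \<in> X \<Longrightarrow> v \<in> X \<and> b \<in> X \<and> c \<in> X"
    "b \<in> X \<Longrightarrow> a \<in> X \<and> d \<in> X \<and> e \<in> X" "c \<in> X \<Longrightarrow> a \<in> X" "d \<in> X \<Longrightarrow> b \<in> X" "e \<in> X \<Longrightarrow> b \<in> X"
    using closed[of v, unfolded Image_attachment_vertex]
      closed[of a, unfolded Image_gadget] closed[of b, unfolded Image_gadget]
      closed[of c, unfolded Image_gadget] closed[of d, unfolded Image_gadget]
      closed[of e, unfolded Image_gadget]
    by (fast+)
  have "X \<inter> pverts G \<noteq> {}"
  proof -
    obtain x where "x \<in> X" "x \<in> pverts H" using X by blast
    then consider "x \<in> pverts G" | "a \<in> X" | "b \<in> X" | "c \<in> X" | "d \<in> X" | "e \<in> X"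
      by (auto simp: pverts_H)
    then have "X \<inter> pverts G \<noteq> {} \<or> v \<in> X"
      by cases (use spread \<open>x \<in> X\<close> in blast)+
    with v_in show ?thesis by blast
  qed
  moreover have "parcs G `` (X \<inter> pverts G) \<subseteq> X \<inter> pverts G"
    using X in_arcsD2 unfolding parcs_H by blast
  ultimately have "X \<inter> pverts G = pverts G"
    using conn unfolding connected_iff_no_closed_subset by blast
  moreover from this have "{a, b, c, d, e} \<subseteq> X"
    using v_in spread(1-3) by blast
  ultimately show "X = pverts H"
    using X unfolding pverts_H by blast
qed

lemma degree_H:
  "u \<in> pverts G \<Longrightarrow> out_degree (with_proj H) u = out_degree (with_proj G) u + (if u = v then 1 else 0)"
  "u \<in> {a, b, c, d, e} \<Longrightarrow> out_degree (with_proj H) u = 3"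
proof -
  assume u: "u \<in> pverts G"
  have "finite (parcs G `` {v})" "a \<notin> parcs G `` {v}"
    using pair_finite_arcs by (auto intro: finite_Image simp: no_arc_at_fresh_vertex)
  with u show "out_degree (with_proj H) u = out_degree (with_proj G) u + (if u = v then 1 else 0)"
    by (auto simp: H.out_degree_eq_card_Image out_degree_eq_card_Image Image_old)
next
  assume "u \<in> {a, b, c, d, e}"
  then show "out_degree (with_proj H) u = 3"
    by (auto simp: H.out_degree_eq_card_Image)
qed

lemma subcubic_H:
  assumes "subcubic G" and "out_degree (with_proj G) v < 3"
  shows "subcubic H"
  unfolding subcubic_def
proof
  fix u assume "u \<in> pverts H"
  then consider "u \<in> pverts G" | "u \<in> {a, b, c, d, e}" by (auto simp: pverts_H)
  then show "out_degree (with_proj H) u \<le> 3"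
    by cases (use assms in \<open>auto simp: degree_H subcubic_def\<close>)
qed

text \<open>
  An independent set has at most two gadget vertices: if it meets \<open>b, c\<close>, then it avoids \<open>a, d, e\<close>;
  otherwise it can have \<open>a\<close> and one end of the edge \<open>de\<close>.
\<close>

lemma independence_number_H: "independence_number H \<le> independence_number G + 2"
proof -
  obtain S where S: "independent_set H S" "card S = independence_number H"
    using H.independence_number_attained by blast
  let ?R = "{a, b, c, d, e}"
  have S_sub: "S \<subseteq> pverts G \<union> ?R" and indep: "\<And>u w. u \<in> S \<Longrightarrow> w \<in> S \<Longrightarrow> w \<notin> parcs H `` {u}"
    using S(1) by (auto simp: independent_set_def pverts_H)
  have "independent_set G (S \<inter> pverts G)"
    using indep by (auto simp: independent_set_def parcs_H)
  then have old: "card (S \<inter> pverts G) \<le> independence_number G"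
    by (rule card_le_independence_number)
  have "S \<inter> ?R \<subseteq> {b, c} \<or> (\<exists>y\<in>{d, e}. S \<inter> ?R \<subseteq> {a, y})"
    using indep[of a] indep[of b] indep[of c] indep[of d e] by auto
  then have "\<exists>x y. S \<inter> ?R \<subseteq> {x, y}" by blast
  then obtain x y where "S \<inter> ?R \<subseteq> {x, y}" by blast
  then have "card (S \<inter> ?R) \<le> card {x, y}"
    by (intro card_mono) auto
  also have "\<dots> \<le> 2" by (simp add: card_insert_if)
  finally have new: "card (S \<inter> ?R) \<le> 2" .
  have "S = (S \<inter> pverts G) \<union> (S \<inter> ?R)" using S_sub by blast
  then have "card S \<le> card (S \<inter> pverts G) + card (S \<inter> ?R)"
    by (metis card_Un_le)
  with old new S(2) show ?thesis by linarith
qed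

lemma zero_forcing_set_meets_gadget_twins:
  assumes B: "zero_forcing_set H B"
  shows "B \<inter> {b, c} \<noteq> {}" "B \<inter> {d, e} \<noteq> {}"
proof -
  show "B \<inter> {b, c} \<noteq> {}"
    by (rule H.zero_forcing_set_meets_twins[OF B]) (auto simp: pverts_H parcs_H gadget_edges_def no_arc_at_fresh_vertex)
  show "B \<inter> {d, e} \<noteq> {}"
    by (rule H.zero_forcing_set_meets_twins[OF B]) (auto simp: pverts_H parcs_H gadget_edges_def no_arc_at_fresh_vertex)
qed

text \<open>
  The gadget touches \<open>G\<close> only through the edge \<open>va\<close>. Once both \<open>v\<close> and the gadget are blue, the white
  neighbours in \<open>H\<close> are those in \<open>G\<close>.
\<close>

lemma stalled_Un_gadget:
  assumes C: "stalled G C" and v: "v \<in> C"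
  shows "stalled H (C \<union> {a, b, c, d, e})"
  unfolding stalled_def
proof (intro conjI ballI allI)
  have C_sub: "C \<subseteq> pverts G" using C by (simp add: stalled_def)
  then show "C \<union> {a, b, c, d, e} \<subseteq> pverts H" by (auto simp: pverts_H)
  fix u w
  have old: "parcs G `` {u} - (C \<union> {a, b, c, d, e}) = parcs G `` {u} - C"
    using in_arcsD2 fresh by blast
  assume "u \<in> C \<union> {a, b, c, d, e}"
  then consider "u \<in> C" "u \<noteq> v" | "u = v" | "u = a" | "u = b" | "u = c" | "u = d" | "u = e"
    by blast
  then have "u \<in> C \<and> parcs H `` {u} - (C \<union> {a, b, c, d, e}) = parcs G `` {u} - C
      \<or> parcs H `` {u} - (C \<union> {a, b, c, d, e}) = {}"
  proof cases
    case 1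
    then have "parcs H `` {u} = parcs G `` {u}" using C_sub by (intro Image_old) auto
    with 1 old show ?thesis by simp
  next
    case 2
    with v old show ?thesis by (simp add: insert_Diff_if)
  qed (use v in \<open>simp_all add: insert_Diff_if\<close>)
  moreover have "parcs G `` {u} - C \<noteq> {w}" if "u \<in> C"
    using C that unfolding stalled_def by blast
  ultimately show "parcs H `` {u} - (C \<union> {a, b, c, d, e}) \<noteq> {w}"
    by (metis empty_not_insert)
qed

text \<open>
  As long as \<open>v\<close> is white, one vertex from each pair of twins starts nothing. The vertex
  \<open>x\<close> has the white neighbours \<open>a\<close> and the twin of \<open>y\<close>, and \<open>y\<close> has the white neighbours \<open>b, c, d, e\<close>
  other than \<open>x, y\<close>.
\<close>

lemma stalled_Un_two_gadget_vertices:
  assumes C: "stalled G C" and v: "v \<notin> C" and x: "x \<in> {b, c}" and y: "y \<in> {d, e}"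
  shows "stalled H (C \<union> {x, y})"
  unfolding stalled_def
proof (intro conjI ballI allI)
  have C_sub: "C \<subseteq> pverts G" using C by (simp add: stalled_def)
  then show "C \<union> {x, y} \<subseteq> pverts H" using x y by (auto simp: pverts_H)
  have notC: "a \<notin> C" "b \<notin> C" "c \<notin> C" "d \<notin> C" "e \<notin> C" using C_sub fresh by auto
  consider "x = b" "y = d" | "x = b" "y = e" | "x = c" "y = d" | "x = c" "y = e"
    using x y by blast
  then have two_white: "card (parcs H `` {x} - (C \<union> {x, y})) = 2"
    "card (parcs H `` {y} - (C \<union> {x, y})) = 2"
    by (cases; simp add: insert_Diff_if notC)+
  fix u w
  assume "u \<in> C \<union> {x, y}"
  then consider "u \<in> C" | "u = x \<or> u = y" by blast
  then show "parcs H `` {u} - (C \<union> {x, y}) \<noteq> {w}"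
  proof cases
    case 1
    have "parcs G `` {u} - (C \<union> {x, y}) = parcs G `` {u} - C"
      using in_arcsD2 fresh x y by blast
    with 1 C C_sub v show ?thesis
      by (metis Image_old stalled_def subsetD)
  next
    case 2
    then have "card (parcs H `` {u} - (C \<union> {x, y})) = 2"
      using two_white by metis
    then show ?thesis by (metis card_1_singleton_iff numeral_eq_one_iff One_nat_def semiring_norm(85))
  qed
qed

text \<open>
  A minimum zero forcing set \<open>B\<close> of \<open>H\<close> is turned into one of \<open>G\<close> by dropping its gadget vertices,
  and adding \<open>v\<close> if there are more than the two that the twins demand.
\<close>

lemma zero_forcing_number_H: "zero_forcing_number G + 2 \<le> zero_forcing_number H"
proof -
  let ?R = "{a, b, c, d, e}"
  obtain B where B: "zero_forcing_set H B" and card_B: "card B = zero_forcing_number H"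
    using H.zero_forcing_number_attained by blast
  have B_sub: "B \<subseteq> pverts H" using B by (simp add: zero_forcing_set_def)
  then have fin: "finite B" using H.pair_finite_verts finite_subset by blast
  have forced: "C = pverts H" if "B \<subseteq> C" "stalled H C" for C
    using B that unfolding H.zero_forcing_set_iff_stalled[OF B_sub] by blast
  obtain x y where x: "x \<in> B" "x \<in> {b, c}" and y: "y \<in> B" "y \<in> {d, e}"
    using zero_forcing_set_meets_gadget_twins[OF B] by blast
  have xy: "x \<noteq> y" "{x, y} \<subseteq> B \<inter> ?R" and a_neq: "a \<notin> {x, y}"
  proof -
    show "x \<noteq> y" using x(2) y(2) by (metis fresh_simps(11-14) insertE singletonD)
    show "{x, y} \<subseteq> B \<inter> ?R" using x y by blast
    show "a \<notin> {x, y}" using x(2) y(2) by (metis fresh_simps(6-9) insertE singletonD)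
  qed
  let ?B' = "(B \<inter> pverts G) \<union> (if B \<inter> ?R = {x, y} then {} else {v})"
  have B'_sub: "?B' \<subseteq> pverts G" using v_in by auto
  have "C = pverts G" if C: "?B' \<subseteq> C" "stalled G C" for C
  proof -
    have C_sub: "C \<subseteq> pverts G" using C by (simp add: stalled_def)
    \<comment> \<open>otherwise \<open>B\<close> lies in the stalled set \<open>C \<union> {x, y}\<close>, which misses \<open>a\<close>\<close>
    have v: "v \<in> C"
    proof (rule ccontr)
      assume v: "v \<notin> C"
      have two: "B \<inter> ?R = {x, y}"
      proof (rule ccontr)
        assume "B \<inter> ?R \<noteq> {x, y}"
        with C(1) have "v \<in> C" by simp
        with v show False by blast
      qed
      have "B \<subseteq> (B \<inter> pverts G) \<union> (B \<inter> ?R)" using B_sub unfolding pverts_H by blast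
      also have "\<dots> \<subseteq> C \<union> {x, y}" using C(1) unfolding two by blast
      finally have "C \<union> {x, y} = pverts H"
        by (rule forced[OF _ stalled_Un_two_gadget_vertices[OF C(2) v x(2) y(2)]])
      then have "a \<in> C \<union> {x, y}" by (simp add: pverts_H)
      with C_sub a_neq fresh show False by blast
    qed
    have "B \<subseteq> C \<union> ?R" using B_sub C unfolding pverts_H by blast
    then have "C \<union> ?R = pverts H"
      using stalled_Un_gadget[OF C(2) v] by (rule forced)
    with C_sub fresh show ?thesis unfolding pverts_H by blast
  qed
  then have "zero_forcing_set G ?B'"
    unfolding zero_forcing_set_iff_stalled[OF B'_sub] by blast
  then have Z: "zero_forcing_number G \<le> card ?B'"
    by (rule zero_forcing_number_le_card)
  have "B = (B \<inter> pverts G) \<union> (B \<inter> ?R)" using B_sub unfolding pverts_H by blast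
  moreover have "(B \<inter> pverts G) \<inter> (B \<inter> ?R) = {}" using fresh by blast
  ultimately have split: "card B = card (B \<inter> pverts G) + card (B \<inter> ?R)"
    using fin by (metis card_Un_disjoint finite_Int)
  have "card ?B' + 2 \<le> card B"
  proof (cases "B \<inter> ?R = {x, y}")
    case True
    with xy split show ?thesis by simp
  next
    case False
    with xy have "card {x, y} < card (B \<inter> ?R)"
      by (intro psubset_card_mono) auto
    moreover have "card ?B' \<le> card (B \<inter> pverts G) + 1"
      using False fin by (simp add: card_insert_if)
    ultimately show ?thesis using xy split by simp
  qed
  with Z card_B show ?thesis by linarith
qed

end


section \<open>Relabelling vertices\<close>

definition relabel :: "('a \<Rightarrow> 'b) \<Rightarrow> 'a pair_pre_digraph \<Rightarrow> 'b pair_pre_digraph" where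
  "relabel f G = \<lparr> pverts = f ` pverts G, parcs = map_prod f f ` parcs G \<rparr>"

locale relabelled_graph = pair_graph G for G :: "'a pair_pre_digraph" +
  fixes f :: "'a \<Rightarrow> 'b"
  assumes inj: "inj_on f (pverts G)"
begin

abbreviation K :: "'b pair_pre_digraph" where
  "K \<equiv> relabel f G"

lemma pverts_K: "pverts K = f ` pverts G"
  by (simp add: relabel_def)

lemma parcs_K_iff:
  assumes "u \<in> pverts G" "w \<in> pverts G"
  shows "(f u, f w) \<in> parcs K \<longleftrightarrow> (u, w) \<in> parcs G"
proof
  assume "(f u, f w) \<in> parcs K"
  then obtain x y where xy: "(x, y) \<in> parcs G" "f u = f x" "f w = f y"
    by (auto simp: relabel_def)
  then have "u = x" "w = y"
    using assms inj wellformed' by (auto dest: inj_onD)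
  with xy show "(u, w) \<in> parcs G" by simp
qed (force simp: relabel_def)

lemma Image_K:
  assumes "u \<in> pverts G"
  shows "parcs K `` {f u} = f ` (parcs G `` {u})"
proof -
  have "parcs K `` {f u} \<subseteq> f ` pverts G"
    using wellformed' by (auto simp: relabel_def)
  then show ?thesis
    using assms parcs_K_iff wellformed' by (auto simp: image_iff) blast+
qed

lemma pair_graph_K: "pair_graph K"
proof (rule pair_graphI)
  show "pair_wf_digraph K"
    using wellformed' by unfold_locales (auto simp: relabel_def)
  show "finite (parcs K)" "finite (pverts K)"
    using pair_finite_arcs pair_finite_verts by (simp_all add: relabel_def)
  show "symmetric (with_proj K)"
    using arcs_symmetric unfolding symmetric_def sym_def by (fastforce simp: relabel_def)
  show "fst x \<noteq> snd x" if x: "x \<in> parcs K" for x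
  proof -
    obtain u w where uw: "(u, w) \<in> parcs G" "x = (f u, f w)"
      using x by (auto simp: relabel_def)
    then have "f u \<noteq> f w"
      using no_loops' wellformed' inj by (metis inj_onD)
    with uw show ?thesis by simp
  qed
qed

sublocale K: pair_graph K
  by (rule pair_graph_K)

lemma connected_K:
  assumes conn: "Digraph_Component.connected (with_proj G)"
  shows "Digraph_Component.connected (with_proj K)"
  unfolding K.connected_iff_no_closed_subset
proof (intro conjI allI impI)
  show "pverts K \<noteq> {}"
    using conn unfolding connected_iff_no_closed_subset by (auto simp: pverts_K)
  fix X
  assume X: "X \<subseteq> pverts K \<and> X \<noteq> {} \<and> parcs K `` X \<subseteq> X"
  let ?Y = "{u \<in> pverts G. f u \<in> X}"
  have "?Y \<noteq> {}" using X unfolding pverts_K by blast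
  moreover have "parcs G `` ?Y \<subseteq> ?Y"
  proof
    fix w assume "w \<in> parcs G `` ?Y"
    then obtain u where u: "u \<in> ?Y" "(u, w) \<in> parcs G" by blast
    then have "(f u, f w) \<in> parcs K" using parcs_K_iff wellformed' by blast
    with X u in_arcsD2 show "w \<in> ?Y" by blast
  qed
  ultimately have "?Y = pverts G"
    by (intro conjunct2[OF conn[unfolded connected_iff_no_closed_subset], rule_format] conjI) auto
  then show "X = pverts K" using X unfolding pverts_K by blast
qed

lemma degree_K:
  assumes "u \<in> pverts G"
  shows "out_degree (with_proj K) (f u) = out_degree (with_proj G) u"
proof -
  have "inj_on f (parcs G `` {u})"
    using inj in_arcsD2 by (auto intro: inj_on_subset)
  then show ?thesis
    by (simp add: K.out_degree_eq_card_Image out_degree_eq_card_Image Image_K[OF assms] card_image)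
qed

lemma card_pullback:
  assumes "S \<subseteq> pverts K"
  shows "card {u \<in> pverts G. f u \<in> S} = card S"
proof -
  have "f ` {u \<in> pverts G. f u \<in> S} = S"
    using assms by (auto simp: pverts_K)
  moreover have "inj_on f {u \<in> pverts G. f u \<in> S}"
    using inj by (rule inj_on_subset) blast
  ultimately show ?thesis by (metis card_image)
qed

text \<open>
  Both parameters are invariant under relabelling. The two inequalities below are the ones that carry
  a bound on \<open>Z - \<alpha>\<close> from the relabelled graph back to \<open>G\<close>.
\<close>

lemma independence_number_K: "independence_number K \<le> independence_number G"
proof -
  obtain S where S: "independent_set K S" "card S = independence_number K"
    using K.independence_number_attained by blast
  have "independent_set G {u \<in> pverts G. f u \<in> S}"
    using S(1) parcs_K_iff unfolding independent_set_def by blast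
  then have "card {u \<in> pverts G. f u \<in> S} \<le> independence_number G"
    by (rule card_le_independence_number)
  with S card_pullback show ?thesis
    by (simp add: independent_set_def)
qed

lemma zero_forcing_number_K: "zero_forcing_number G \<le> zero_forcing_number K"
proof -
  obtain B where B: "zero_forcing_set K B" and card_B: "card B = zero_forcing_number K"
    using K.zero_forcing_number_attained by blast
  have B_sub: "B \<subseteq> pverts K" using B by (simp add: zero_forcing_set_def)
  let ?B' = "{u \<in> pverts G. f u \<in> B}"
  have B'_sub: "?B' \<subseteq> pverts G" by blast
  have "C = pverts G" if C: "?B' \<subseteq> C" "stalled G C" for C
  proof -
    have C_sub: "C \<subseteq> pverts G" using C by (simp add: stalled_def)
    have "stalled K (f ` C)"
      unfolding stalled_def
    proof (intro conjI ballI allI notI)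
      show "f ` C \<subseteq> pverts K" using C_sub by (auto simp: pverts_K)
      fix u' w'
      assume "u' \<in> f ` C" and white: "parcs K `` {u'} - f ` C = {w'}"
      then obtain u where u: "u \<in> C" "u' = f u" by blast
      have "parcs K `` {u'} = f ` (parcs G `` {u})"
        using u C_sub by (simp add: Image_K subset_iff)
      moreover have "parcs G `` {u} \<subseteq> pverts G" using in_arcsD2 by blast
      ultimately have "parcs K `` {u'} - f ` C = f ` (parcs G `` {u} - C)"
        using C_sub inj_on_image_set_diff[OF inj, of "parcs G `` {u}" C] by auto
      with white have "card (f ` (parcs G `` {u} - C)) = 1" by simp
      moreover have "inj_on f (parcs G `` {u} - C)"
        using inj in_arcsD2 by (auto intro: inj_on_subset)
      ultimately obtain w where "parcs G `` {u} - C = {w}"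
        by (metis card_1_singletonE card_image)
      with C u show False by (auto simp: stalled_def)
    qed
    moreover have "B \<subseteq> f ` C" using B_sub C unfolding pverts_K by blast
    ultimately have "f ` C = f ` pverts G"
      using B unfolding K.zero_forcing_set_iff_stalled[OF B_sub] pverts_K by blast
    with C_sub inj show ?thesis by (simp add: inj_on_image_eq_iff)
  qed
  then have "zero_forcing_set G ?B'"
    unfolding zero_forcing_set_iff_stalled[OF B'_sub] by blast
  then have "zero_forcing_number G \<le> card ?B'"
    by (rule zero_forcing_number_le_card)
  with card_B card_pullback[OF B_sub] show ?thesis by simp
qed

end


section \<open>From cubic to subcubic graphs\<close>

definition cubic_deficiency :: "'a pair_pre_digraph \<Rightarrow> nat" where
  "cubic_deficiency G = (\<Sum>u\<in>pverts G. 3 - out_degree (with_proj G) u)"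

lemma (in gadget_attachment) cubic_deficiency_H:
  assumes "out_degree (with_proj G) v < 3"
  shows "cubic_deficiency H < cubic_deficiency G"
proof -
  have "cubic_deficiency H = (\<Sum>u\<in>pverts G. 3 - out_degree (with_proj H) u) +
      (\<Sum>u\<in>{a, b, c, d, e}. 3 - out_degree (with_proj H) u)"
    unfolding cubic_deficiency_def pverts_H
    by (rule sum.union_disjoint) (use pair_finite_verts fresh in auto)
  also have "\<dots> = (\<Sum>u\<in>pverts G. 3 - out_degree (with_proj H) u)"
    by (simp add: degree_H(2))
  also have "\<dots> < cubic_deficiency G"
    unfolding cubic_deficiency_def
  proof (rule sum_strict_mono_ex1)
    show "\<exists>u\<in>pverts G. 3 - out_degree (with_proj H) u < 3 - out_degree (with_proj G) u"
      using v_in assms by (intro bexI[of _ v]) (simp_all add: degree_H(1))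
  qed (use pair_finite_verts in \<open>auto simp: degree_H(1)\<close>)
  finally show ?thesis .
qed

text \<open>
  Attaching a gadget to a vertex of degree less than three lowers the cubic deficiency by one, as the
  gadget vertices contribute nothing. A subcubic graph of deficiency zero is cubic.
\<close>

lemma subcubic_bound_of_cubic_bound:
  fixes k :: int and G :: "nat pair_pre_digraph"
  assumes cubic_bound: "\<And>H :: nat pair_pre_digraph.
      pair_graph H \<Longrightarrow> Digraph_Component.connected (with_proj H) \<Longrightarrow> cubic H \<Longrightarrow>
      int (zero_forcing_number H) \<le> int (independence_number H) + k"
    and "pair_graph G" and "Digraph_Component.connected (with_proj G)" and "subcubic G"
  shows "int (zero_forcing_number G) \<le> int (independence_number G) + k"
  using assms(2-4)
proof (induction "cubic_deficiency G" arbitrary: G rule: less_induct)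
  case less
  show ?case
  proof (cases "cubic G")
    case True
    with less cubic_bound show ?thesis by blast
  next
    case False
    then obtain v where v: "v \<in> pverts G" "out_degree (with_proj G) v < 3"
      using less.prems(3) unfolding cubic_def subcubic_def by (meson le_neq_implies_less)
    define n where "n = Suc (Max (pverts G))"
    have "finite (pverts G)"
      using less.prems(1) by (simp add: pair_graph_def pair_digraph_def pair_fin_digraph_def
          pair_fin_digraph_axioms_def)
    then have n: "u < n" if "u \<in> pverts G" for u
      using that by (simp add: n_def less_Suc_eq_le)
    interpret pair_graph G by (rule less.prems(1))
    interpret gadget_attachment G v n "n + 1" "n + 2" "n + 3" "n + 4"
      by unfold_locales (use v n in \<open>fastforce+\<close>)
    have "int (zero_forcing_number H) \<le> int (independence_number H) + k"
      using cubic_deficiency_H[OF v(2)] pair_graph_H connected_H[OF less.prems(2)]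
        subcubic_H[OF less.prems(3) v(2)]
      by (rule less.hyps)
    with zero_forcing_number_H independence_number_H show ?thesis by linarith
  qed
qed

theorem theorem18:
  fixes c :: int and G :: "'a pair_pre_digraph"
  assumes "\<And>H :: nat pair_pre_digraph.
      pair_graph H \<Longrightarrow> Digraph_Component.connected (with_proj H) \<Longrightarrow> cubic H \<Longrightarrow>
      int (zero_forcing_number H) \<le> int (independence_number H) + c"
    and "pair_graph G" and "Digraph_Component.connected (with_proj G)" and "subcubic G"
  shows "int (zero_forcing_number G) \<le> int (independence_number G) + c"
proof -
  interpret pair_graph G by fact
  obtain f :: "'a \<Rightarrow> nat" where "inj_on f (pverts G)"
    using finite_imp_inj_to_nat_seg[OF pair_finite_verts] by blast
  then interpret relabelled_graph G f by unfold_locales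
  have "subcubic K"
    using assms(4) by (auto simp: subcubic_def pverts_K degree_K)
  with assms(1) have "int (zero_forcing_number K) \<le> int (independence_number K) + c"
    by (rule subcubic_bound_of_cubic_bound[OF _ pair_graph_K connected_K[OF assms(3)]])
  with zero_forcing_number_K independence_number_K show ?thesis by linarith
qed

end
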